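(* Let $Z=\mathrm{diag}(z_1,\dots,z_m)\in\mathbb{C}^{m\times m}$ with pairwise distinct nodes $z_i\in\mathbb{C}$, let $v\in\mathbb{C}^m$ be a vector all of whose entries are nonzero, and let $\Xi=\{\xi_i\}_{i=1}^{m-1}$, $\xi_i\in\overline{\mathbb{C}}=\mathbb{C}\cup\{\infty\}$, be poles with $\xi_i\notin\{z_1,\dots,z_m\}$. Let the unitary matrix $Q\in\mathbb{C}^{m\times m}$ and the Hessenberg matrices $H,K\in\mathbb{C}^{m\times m}$ be obtained by applying the rational Arnoldi iteration for $\mathcal{K}_m(Z,v;\Xi)$. Then these matrices solve the Hessenberg pencil inverse eigenvalue problem for $Z$, $v$, $\Xi$, that is: $H$ and $K$ are upper Hessenberg, $Q$ is unitary, $$Q^HZQK=H,\qquad Qe_1=\frac{v}{\|v\|},\qquad \frac{h_{i+1,i}}{k_{i+1,i}}=\xi_i,\quad i=1,\dots,m-1 .$$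
   Context: Notation: $e_i$ is the $i$th canonical unit vector, $\langle x,y\rangle=y^Hx$ the Euclidean inner product on $\mathbb{C}^m$. Poles are written $\xi_i=\nu_i/\mu_i$ with $(\mu_i,\nu_i)\in\mathbb{C}^2\setminus\{(0,0)\}$ ($\mu_i=0$ means $\xi_i=\infty$). A ratio $h/k$ equals $\xi=\nu/\mu\in\overline{\mathbb{C}}$ means $(h,k)\neq(0,0)$ and $\mu h=\nu k$. For commuting $B$, $C^{-1}$, $\frac{B}{C}:=BC^{-1}$. Rational Krylov subspace: for $A\in\mathbb{C}^{m\times m}$, $v\in\mathbb{C}^m$, $$\mathcal{K}_n(A,v;\Xi)=\mathrm{span}\Big\{v,\tfrac{\rho_1A-\eta_1I}{\mu_1A-\nu_1I}t_1,\dots,\tfrac{\rho_{n-1}A-\eta_{n-1}I}{\mu_{n-1}A-\nu_{n-1}I}t_{n-1}\Big\},$$ where the shift parameters satisfy $\rho_i,\eta_i\in\mathbb{C}$, $\eta_i/\rho_i\ne\nu_i/\mu_i$ (i.e. $\rho_i\nu_i\neq\eta_i\mu_i$), and the continuation vectors $t_i\in\mathcal{K}_i(A,v;\Xi)$ are chosen such that $\dim\mathcal{K}_n(A,v;\Xi)=n$ for all $n\le m$. Rational Arnoldi iteration for $\mathcal{K}_m(A,v;\Xi)$: set $q_1=v/\|v\|$. For $k=1,\dots,m-1$, given orthonormal $q_1,\dots,q_k$ spanning $\mathcal{K}_k(A,v;\Xi)$, write the continuation vector as $t_k=\sum_{i=1}^kc_{i,k}q_i$, compute $\tilde q_{k+1}=(\rho_kA-\eta_kI)(\mu_kA-\nu_kI)^{-1}t_k$,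 set $g_{i,k}=\langle\tilde q_{k+1},q_i\rangle$ for $i\le k$ and $g_{k+1,k}q_{k+1}=\tilde q_{k+1}-\sum_{i=1}^kg_{i,k}q_i$, with $g_{k+1,k}\neq0$ chosen so that $\|q_{k+1}\|=1$. For the last step $k=m$ the same formulas are used with auxiliary parameters $\mu_m,\nu_m,\rho_m,\eta_m$ such that $\mu_mA-\nu_mI$ is invertible and $\rho_m\nu_m\ne\eta_m\mu_m$, and $t_m\in\mathbb{C}^m$; then $g_{m+1,m}=0$ and no new vector is generated. Put $c_{i,k}=0$ for $i>k$ and $g_{i,k}=0$ for $i>k+1$. The output is $Q=[q_1\ \cdots\ q_m]$ and the $m\times m$ matrices $H,K$ with entries $h_{i,k}=\nu_kg_{i,k}-\eta_kc_{i,k}$ and $k_{i,k}=\mu_kg_{i,k}-\rho_kc_{i,k}$, $1\le i,k\le m$. *)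

theory Defs
  imports
    "Jordan_Normal_Form.Gauss_Jordan_Elimination"
    "Jordan_Normal_Form.Schur_Decomposition"
    "Jordan_Normal_Form.DL_Rank"
    Complex_Main
begin

text \<open>
  All indices start at 0: \<open>\<xi>\<^sub>1, \<dots>, \<xi>\<^sub>m\<^sub>-\<^sub>1\<close>, \<open>t\<^sub>1, \<dots>, t\<^sub>m\<close>, \<open>q\<^sub>1, \<dots>, q\<^sub>m\<close> of the usual
  notation have index \<open>i - 1\<close> here, in agreement with the numbering of matrix entries.

  A point of the extended complex plane is given by homogeneous coordinates \<open>\<nu> / \<mu>\<close> with
  \<open>(\<mu>, \<nu>) \<noteq> (0, 0)\<close>, where \<open>\<mu> = 0\<close> means \<open>\<infinity>\<close>. The next predicate says \<open>h / k = \<nu> / \<mu>\<close> in this sense.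
\<close>

definition ratio_eq :: "complex \<Rightarrow> complex \<Rightarrow> complex \<Rightarrow> complex \<Rightarrow> bool" where
  "ratio_eq h k \<nu> \<mu> \<longleftrightarrow> (h, k) \<noteq> (0, 0) \<and> \<mu> * h = \<nu> * k"

text \<open>
  The quotient \<open>B / C = B C\<^sup>-\<^sup>1\<close>, only meaningful for invertible \<open>C\<close>
  (otherwise \<open>mat_inverse C = None\<close> and the value is unspecified).
\<close>

definition mat_quot :: "'a :: field mat \<Rightarrow> 'a mat \<Rightarrow> 'a mat" where
  "mat_quot B C = B * the (mat_inverse C)"

definition rat_factor ::
  "'a :: field mat \<Rightarrow> 'a \<Rightarrow> 'a \<Rightarrow> 'a \<Rightarrow> 'a \<Rightarrow> 'a mat" where
  "rat_factor A \<rho> \<eta> \<mu> \<nu> =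
     mat_quot (\<rho> \<cdot>\<^sub>m A - \<eta> \<cdot>\<^sub>m 1\<^sub>m (dim_row A)) (\<mu> \<cdot>\<^sub>m A - \<nu> \<cdot>\<^sub>m 1\<^sub>m (dim_row A))"

text \<open>
  \<open>rational_krylov \<dots> k\<close> is \<open>K\<^sub>k(A, v; \<Xi>)\<close> for \<open>k \<ge> 1\<close>; it is spanned by \<open>v\<close> and \<open>k - 1\<close> further vectors.
\<close>

definition (in vec_space) rational_krylov ::
  "'a mat \<Rightarrow> 'a vec \<Rightarrow> (nat \<Rightarrow> 'a) \<Rightarrow> (nat \<Rightarrow> 'a) \<Rightarrow> (nat \<Rightarrow> 'a) \<Rightarrow> (nat \<Rightarrow> 'a)
    \<Rightarrow> (nat \<Rightarrow> 'a vec) \<Rightarrow> nat \<Rightarrow> 'a vec set" where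
  "rational_krylov A v \<mu> \<nu> \<rho> \<eta> t k =
     span (insert v ((\<lambda>i. rat_factor A (\<rho> i) (\<eta> i) (\<mu> i) (\<nu> i) *\<^sub>v t i) ` {i. Suc i < k}))"

definition (in vec_space) krylov_admissible ::
  "'a mat \<Rightarrow> 'a vec \<Rightarrow> (nat \<Rightarrow> 'a) \<Rightarrow> (nat \<Rightarrow> 'a) \<Rightarrow> (nat \<Rightarrow> 'a) \<Rightarrow> (nat \<Rightarrow> 'a)
    \<Rightarrow> (nat \<Rightarrow> 'a vec) \<Rightarrow> bool" where
  "krylov_admissible A v \<mu> \<nu> \<rho> \<eta> t \<longleftrightarrow>
     (\<forall>i. Suc i < n \<longrightarrow>
        \<rho> i * \<nu> i \<noteq> \<eta> i * \<mu> i \<and> t i \<in> rational_krylov A v \<mu> \<nu> \<rho> \<eta> t (Suc i)) \<and>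
     (\<forall>k\<in>{1..n}. vectorspace.dim class_ring (vs (rational_krylov A v \<mu> \<nu> \<rho> \<eta> t k)) = k)"

text \<open>
  The inner product \<open>\<langle>x, y\<rangle> = y\<^sup>H x\<close> is \<open>x \<bullet>c y\<close>.
\<close>

definition vec_norm :: "complex vec \<Rightarrow> real" where
  "vec_norm x = sqrt (Re (x \<bullet>c x))"

text \<open>
  The predicate describes the possible runs of the rational Arnoldi iteration; the shift parameters,
  the continuation vectors and the phases of the subdiagonal entries of \<open>g\<close> may be chosen freely.
  The parameters \<open>\<mu>, \<nu>, \<rho>, \<eta>\<close> of the last step \<open>k = m - 1\<close> are the auxiliary ones; in that step
  only the coefficients \<open>g 0 k, \<dots>, g k k\<close> are computed and there is no vector \<open>q m\<close>.
  Orthonormality of the vectors \<open>q\<close> and the fact that they span the Krylov spaces are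
  not required but result from the iteration.
\<close>

definition rational_arnoldi ::
  "nat \<Rightarrow> complex mat \<Rightarrow> complex vec
    \<Rightarrow> (nat \<Rightarrow> complex) \<Rightarrow> (nat \<Rightarrow> complex) \<Rightarrow> (nat \<Rightarrow> complex) \<Rightarrow> (nat \<Rightarrow> complex)
    \<Rightarrow> (nat \<Rightarrow> complex vec) \<Rightarrow> (nat \<Rightarrow> nat \<Rightarrow> complex) \<Rightarrow> (nat \<Rightarrow> nat \<Rightarrow> complex)
    \<Rightarrow> (nat \<Rightarrow> complex vec) \<Rightarrow> bool" where
  "rational_arnoldi m A v \<mu> \<nu> \<rho> \<eta> t c g q \<longleftrightarrow>
     vec_space.krylov_admissible m A v \<mu> \<nu> \<rho> \<eta> t \<and>
     invertible_mat (\<mu> (m - 1) \<cdot>\<^sub>m A - \<nu> (m - 1) \<cdot>\<^sub>m 1\<^sub>m m) \<and>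
     \<rho> (m - 1) * \<nu> (m - 1) \<noteq> \<eta> (m - 1) * \<mu> (m - 1) \<and>
     (\<forall>k<m. q k \<in> carrier_vec m) \<and>
     q 0 = complex_of_real (1 / vec_norm v) \<cdot>\<^sub>v v \<and>
     (\<forall>k<m. t k = finsum_vec TYPE(complex) m (\<lambda>i. c i k \<cdot>\<^sub>v q i) {..k} \<and>
        (let w = rat_factor A (\<rho> k) (\<eta> k) (\<mu> k) (\<nu> k) *\<^sub>v t k in
           (\<forall>i\<le>k. g i k = w \<bullet>c q i) \<and>
           (Suc k < m \<longrightarrow>
              g (Suc k) k \<noteq> 0 \<and>
              g (Suc k) k \<cdot>\<^sub>v q (Suc k)
                = w - finsum_vec TYPE(complex) m (\<lambda>i. g i k \<cdot>\<^sub>v q i) {..k} \<and>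
              vec_norm (q (Suc k)) = 1)) \<and>
        (\<forall>i<m. i > k \<longrightarrow> c i k = 0) \<and>
        (\<forall>i<m. i > Suc k \<longrightarrow> g i k = 0))"

definition arnoldi_Q :: "nat \<Rightarrow> (nat \<Rightarrow> complex vec) \<Rightarrow> complex mat" where
  "arnoldi_Q m q = mat_of_cols m (map q [0..<m])"

definition arnoldi_H ::
  "nat \<Rightarrow> (nat \<Rightarrow> complex) \<Rightarrow> (nat \<Rightarrow> complex)
    \<Rightarrow> (nat \<Rightarrow> nat \<Rightarrow> complex) \<Rightarrow> (nat \<Rightarrow> nat \<Rightarrow> complex) \<Rightarrow> complex mat" where
  "arnoldi_H m \<nu> \<eta> c g = mat m m (\<lambda>(i, k). \<nu> k * g i k - \<eta> k * c i k)"

definition arnoldi_K ::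
  "nat \<Rightarrow> (nat \<Rightarrow> complex) \<Rightarrow> (nat \<Rightarrow> complex)
    \<Rightarrow> (nat \<Rightarrow> nat \<Rightarrow> complex) \<Rightarrow> (nat \<Rightarrow> nat \<Rightarrow> complex) \<Rightarrow> complex mat" where
  "arnoldi_K m \<mu> \<rho> c g = mat m m (\<lambda>(i, k). \<mu> k * g i k - \<rho> k * c i k)"

definition upper_hessenberg :: "'a :: zero mat \<Rightarrow> bool" where
  "upper_hessenberg B \<longleftrightarrow> (\<forall>i<dim_row B. \<forall>j<dim_col B. i > Suc j \<longrightarrow> B $$ (i, j) = 0)"

definition unitary_mat :: "complex mat \<Rightarrow> bool" where
  "unitary_mat U \<longleftrightarrow> square_mat U \<and> inverts_mat (mat_adjoint U) U \<and> inverts_mat U (mat_adjoint U)"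

text \<open>
  \<open>Q\<close>, \<open>H\<close>, \<open>K\<close> solve the Hessenberg pencil inverse eigenvalue problem for the matrix \<open>Z\<close>,
  the vector \<open>v\<close> and the poles \<open>\<nu> i / \<mu> i\<close>, \<open>i < m - 1\<close>.
\<close>

definition solves_hpiep ::
  "nat \<Rightarrow> complex mat \<Rightarrow> complex vec \<Rightarrow> (nat \<Rightarrow> complex) \<Rightarrow> (nat \<Rightarrow> complex)
    \<Rightarrow> complex mat \<Rightarrow> complex mat \<Rightarrow> complex mat \<Rightarrow> bool" where
  "solves_hpiep m Z v \<mu> \<nu> Q H K \<longleftrightarrow>
     Q \<in> carrier_mat m m \<and> H \<in> carrier_mat m m \<and> K \<in> carrier_mat m m \<and>
     upper_hessenberg H \<and> upper_hessenberg K \<and> unitary_mat Q \<and>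
     mat_adjoint Q * Z * Q * K = H \<and>
     Q *\<^sub>v unit_vec m 0 = complex_of_real (1 / vec_norm v) \<cdot>\<^sub>v v \<and>
     (\<forall>i. Suc i < m \<longrightarrow> ratio_eq (H $$ (Suc i, i)) (K $$ (Suc i, i)) (\<nu> i) (\<mu> i))"

end

theory Submission
  imports Defs
begin

text \<open>
  Write \<open>w k\<close> for the rational factor applied to \<open>t k\<close>. The vectors \<open>q k\<close> arise from Gram--Schmidt steps,
  so they form an orthonormal basis in which \<open>t k\<close> and \<open>w k\<close> have the coordinates \<open>c i k\<close> and \<open>g i k\<close>;
  for \<open>k = m - 1\<close> this holds because the basis is already complete. Clearing the denominator in \<open>w k\<close> gives
  \<open>Z (\<mu> k w k - \<rho> k t k) = \<nu> k w k - \<eta> k t k\<close>, which is column \<open>k\<close> of \<open>Z Q K = Q H\<close>.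
\<close>

section \<open>Coordinates and scalar products of linear combinations\<close>

lemma index_finsum_vec_smult:
  fixes x :: "'b \<Rightarrow> 'a :: semiring_0 vec"
  assumes "finite F" "\<And>i. i \<in> F \<Longrightarrow> x i \<in> carrier_vec n" "l < n"
  shows "finsum_vec TYPE('a) n (\<lambda>i. a i \<cdot>\<^sub>v x i) F $ l = (\<Sum>i\<in>F. a i * x i $ l)"
proof -
  have "finsum_vec TYPE('a) n (\<lambda>i. a i \<cdot>\<^sub>v x i) F $ l = (\<Sum>i\<in>F. (a i \<cdot>\<^sub>v x i) $ l)"
    using assms by (intro index_finsum_vec) auto
  also have "\<dots> = (\<Sum>i\<in>F. a i * x i $ l)"
    using assms(3) carrier_vecD[OF assms(2)] by (intro sum.cong) auto
  finally show ?thesis .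
qed

lemma finsum_vec_sprod:
  fixes x :: "'b \<Rightarrow> 'a :: comm_semiring_0 vec"
  assumes "finite F" "\<And>i. i \<in> F \<Longrightarrow> x i \<in> carrier_vec n" "u \<in> carrier_vec n"
  shows "finsum_vec TYPE('a) n (\<lambda>i. a i \<cdot>\<^sub>v x i) F \<bullet> u = (\<Sum>i\<in>F. a i * (x i \<bullet> u))"
proof -
  have "finsum_vec TYPE('a) n (\<lambda>i. a i \<cdot>\<^sub>v x i) F \<bullet> u
      = (\<Sum>l<n. (\<Sum>i\<in>F. a i * x i $ l) * u $ l)"
    using assms
    by (auto simp: scalar_prod_def atLeast0LessThan index_finsum_vec_smult intro!: sum.cong)
  also have "\<dots> = (\<Sum>i\<in>F. \<Sum>l<n. a i * x i $ l * u $ l)"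
    unfolding sum_distrib_right by (rule sum.swap)
  also have "\<dots> = (\<Sum>i\<in>F. a i * (x i \<bullet> u))"
    using assms
    by (auto simp: scalar_prod_def atLeast0LessThan sum_distrib_left mult.assoc intro!: sum.cong
        dest: carrier_vecD)
  finally show ?thesis .
qed

section \<open>Hermitian inner product and norm\<close>

lemma cscalar_prod_swap:
  fixes x y :: "'a :: conjugatable_field vec"
  assumes "x \<in> carrier_vec n" "y \<in> carrier_vec n"
  shows "x \<bullet>c y = conjugate (y \<bullet>c x)"
  using assms conjugate_conjugate_sprod[of x n y] comm_scalar_prod[of "conjugate x" n y] by simp

text \<open>In the order on the complex numbers, nonnegativity forces the imaginary part to vanish,
  so taking the real part in \<open>vec_norm\<close> loses nothing.\<close>

lemma cscalar_prod_self: "x \<bullet>c x = complex_of_real ((vec_norm x)\<^sup>2)"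
proof -
  have ge: "x \<bullet>c x \<ge> 0"
    using conjugate_square_ge_0_vec by blast
  then have "Im (x \<bullet>c x) = 0" "Re (x \<bullet>c x) \<ge> 0"
    by (auto simp: less_eq_complex_def)
  then show ?thesis
    by (simp add: vec_norm_def complex_eq_iff)
qed

lemma vec_norm_pos:
  assumes "x \<in> carrier_vec n" "x \<noteq> 0\<^sub>v n"
  shows "vec_norm x > 0"
proof -
  have "x \<bullet>c x > 0"
    using assms conjugate_square_greater_0_vec by blast
  then show ?thesis
    by (simp add: vec_norm_def less_complex_def)
qed

section \<open>The matrix of basis vectors\<close>

lemma arnoldi_Q_carrier: "arnoldi_Q m q \<in> carrier_mat m m"
  using mat_of_cols_carrier(1)[of m "map q [0..<m]"] by (simp add: arnoldi_Q_def)

lemma arnoldi_Q_index: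
  assumes "i < m" "j < m"
  shows "arnoldi_Q m q $$ (i, j) = q j $ i"
  using assms by (simp add: arnoldi_Q_def mat_of_cols_index)

text \<open>Zero coefficients beyond \<open>k\<close> extend the sum to all columns. Expansions with
  varying upper limits thus become products with one fixed matrix.\<close>

lemma finsum_vec_eq_arnoldi_Q_mult:
  assumes "k < m" "\<And>i. i < m \<Longrightarrow> q i \<in> carrier_vec m"
    and "\<And>i. i < m \<Longrightarrow> i > k \<Longrightarrow> a i = 0"
  shows "finsum_vec TYPE(complex) m (\<lambda>i. a i \<cdot>\<^sub>v q i) {..k} = arnoldi_Q m q *\<^sub>v vec m a"
    (is "?l = ?r")
proof (rule eq_vecI)
  fix l assume "l < dim_vec ?r"
  then have l: "l < m"
    using arnoldi_Q_carrier[of m q] by auto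
  have "?l $ l = (\<Sum>i\<le>k. a i * q i $ l)"
    using assms l by (intro index_finsum_vec_smult) auto
  also have "\<dots> = (\<Sum>i<m. a i * q i $ l)"
    using assms by (intro sum.mono_neutral_left) auto
  also have "\<dots> = ?r $ l"
    using l arnoldi_Q_carrier[of m q]
    by (auto simp: scalar_prod_def atLeast0LessThan arnoldi_Q_index mult.commute intro!: sum.cong)
  finally show "?l $ l = ?r $ l" .
next
  have "?l \<in> carrier_vec m"
    using assms by (intro finsum_vec_closed) auto
  then show "dim_vec ?l = dim_vec ?r"
    using arnoldi_Q_carrier[of m q] by auto
qed

text \<open>The entries of \<open>mat_adjoint Q * Q\<close> are the inner products of the columns,
  in swapped order; a left inverse of a square matrix is also a right inverse.\<close>

lemma unitary_mat_orthonormal_cols: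
  assumes Q: "Q \<in> carrier_mat m m"
    and orth: "\<And>i j. i < m \<Longrightarrow> j < m \<Longrightarrow> col Q i \<bullet>c col Q j = (if i = j then 1 else 0)"
  shows "unitary_mat Q"
proof -
  have adj: "mat_adjoint Q \<in> carrier_mat m m"
    using Q by (auto simp: mat_adjoint_def)
  have "mat_adjoint Q * Q = 1\<^sub>m m"
  proof (rule eq_matI)
    fix i j assume ij: "i < dim_row (1\<^sub>m m :: complex mat)" "j < dim_col (1\<^sub>m m :: complex mat)"
    have "(mat_adjoint Q * Q) $$ (i, j) = conjugate (col Q i) \<bullet> col Q j"
      using ij Q adj by (simp add: mat_adjoint_def)
    also have "\<dots> = col Q j \<bullet>c col Q i"
      using ij Q by (intro comm_scalar_prod[of _ m]) auto
    finally show "(mat_adjoint Q * Q) $$ (i, j) = 1\<^sub>m m $$ (i, j)"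
      using ij orth[of j i] by auto
  qed (use Q adj in auto)
  moreover from this have "Q * mat_adjoint Q = 1\<^sub>m m"
    by (rule mat_mult_left_right_inverse[OF adj Q])
  ultimately show ?thesis
    using Q adj by (auto simp: unitary_mat_def inverts_mat_def)
qed

section \<open>Inverses and the rational factor\<close>

lemma the_mat_inverse:
  assumes C: "C \<in> carrier_mat n n" and inv: "invertible_mat C"
  shows "the (mat_inverse C) \<in> carrier_mat n n" "C * the (mat_inverse C) = 1\<^sub>m n"
proof -
  obtain B where B: "C * B = 1\<^sub>m n" "B * C = 1\<^sub>m (dim_row B)"
    using inv C by (auto simp: invertible_mat_def inverts_mat_def)
  \<comment> \<open>\<open>invertible_mat\<close> does not fix the dimensions of the inverse; they
    are read off the two product equations.\<close>
  have "dim_col B = n"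
    using arg_cong[OF B(1), of dim_col] by simp
  moreover have "dim_row B = n"
    using arg_cong[OF B(2), of dim_col] C by simp
  \<comment> \<open>\<open>mat_inverse\<close> is specified through the units of the matrix ring:
    the value \<open>None\<close> would mean that \<open>C\<close> is not a unit.\<close>
  ultimately have "C \<in> Units (ring_mat TYPE('a) n ())"
    using B C by (auto simp: Units_def ring_mat_def)
  then obtain D where "mat_inverse C = Some D"
    using mat_inverse(1)[OF C, of "()"] by (cases "mat_inverse C") auto
  then show "the (mat_inverse C) \<in> carrier_mat n n" "C * the (mat_inverse C) = 1\<^sub>m n"
    using mat_inverse(2)[OF C] by auto
qed

text \<open>With \<open>t = (\<mu> A - \<nu> I) u\<close> and \<open>w = (\<rho> A - \<eta> I) u\<close>, both sides equal \<open>(\<rho> \<nu> - \<eta> \<mu>) A u\<close>.\<close>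

lemma rat_factor_recurrence:
  fixes A :: "'a :: field mat" and \<mu> \<nu> \<rho> \<eta> :: 'a
  assumes A: "A \<in> carrier_mat n n" and inv: "invertible_mat (\<mu> \<cdot>\<^sub>m A - \<nu> \<cdot>\<^sub>m 1\<^sub>m n)"
    and t: "t \<in> carrier_vec n"
  defines "w \<equiv> rat_factor A \<rho> \<eta> \<mu> \<nu> *\<^sub>v t"
  shows "w \<in> carrier_vec n" "A *\<^sub>v (\<mu> \<cdot>\<^sub>v w - \<rho> \<cdot>\<^sub>v t) = \<nu> \<cdot>\<^sub>v w - \<eta> \<cdot>\<^sub>v t"
proof -
  define C where "C = \<mu> \<cdot>\<^sub>m A - \<nu> \<cdot>\<^sub>m 1\<^sub>m n"
  define B where "B = \<rho> \<cdot>\<^sub>m A - \<eta> \<cdot>\<^sub>m 1\<^sub>m n"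
  define D where "D = the (mat_inverse C)"
  define u where "u = D *\<^sub>v t"
  have car: "C \<in> carrier_mat n n" "B \<in> carrier_mat n n"
    using A by (auto simp: C_def B_def)
  have D: "D \<in> carrier_mat n n" "C * D = 1\<^sub>m n"
    using the_mat_inverse[OF car(1)] inv by (auto simp: C_def D_def)
  have u: "u \<in> carrier_vec n"
    using D t by (auto simp: u_def)
  have Au: "A *\<^sub>v u \<in> carrier_vec n"
    using A u by auto
  have lin: "(a \<cdot>\<^sub>m A - b \<cdot>\<^sub>m 1\<^sub>m n) *\<^sub>v u = a \<cdot>\<^sub>v (A *\<^sub>v u) - b \<cdot>\<^sub>v u" for a b
    using A u by (auto simp: minus_mult_distrib_mat_vec[of _ n n])
  have "w = B * D *\<^sub>v t"
    using A by (simp add: w_def rat_factor_def mat_quot_def B_def C_def D_def)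
  also have "\<dots> = B *\<^sub>v u"
    using car D t by (simp add: u_def)
  finally have w: "w = \<rho> \<cdot>\<^sub>v (A *\<^sub>v u) - \<eta> \<cdot>\<^sub>v u"
    by (simp add: B_def lin)
  then show "w \<in> carrier_vec n"
    using u Au by auto
  have "t = C * D *\<^sub>v t"
    using D t by simp
  also have "\<dots> = C *\<^sub>v u"
    unfolding u_def using car D t by (intro assoc_mult_mat_vec)
  finally have t': "t = \<mu> \<cdot>\<^sub>v (A *\<^sub>v u) - \<nu> \<cdot>\<^sub>v u"
    by (simp add: C_def lin)
  \<comment> \<open>The multiples of \<open>A *\<^sub>v u\<close> cancel here, those of
    \<open>u\<close> in the next identity; the remaining scalar factor is the same in both.\<close>
  have "\<mu> \<cdot>\<^sub>v w - \<rho> \<cdot>\<^sub>v t = (\<rho> * \<nu> - \<eta> * \<mu>) \<cdot>\<^sub>v u"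
    unfolding w t' using A u by (intro eq_vecI) (auto simp: algebra_simps)
  moreover have "\<nu> \<cdot>\<^sub>v w - \<eta> \<cdot>\<^sub>v t = (\<rho> * \<nu> - \<eta> * \<mu>) \<cdot>\<^sub>v (A *\<^sub>v u)"
    unfolding w t' using A u by (intro eq_vecI) (auto simp: algebra_simps)
  ultimately show "A *\<^sub>v (\<mu> \<cdot>\<^sub>v w - \<rho> \<cdot>\<^sub>v t) = \<nu> \<cdot>\<^sub>v w - \<eta> \<cdot>\<^sub>v t"
    using A u by (simp add: mult_mat_vec)
qed

section \<open>Invertibility of shifted diagonal matrices\<close>

lemma invertible_mat_diag:
  fixes d :: "nat \<Rightarrow> 'a :: field"
  assumes "\<And>j. j < n \<Longrightarrow> d j \<noteq> 0"
  shows "invertible_mat (mat_diag n d)"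
proof -
  have "mat_diag n d * mat_diag n (\<lambda>i. inverse (d i)) = 1\<^sub>m n"
       "mat_diag n (\<lambda>i. inverse (d i)) * mat_diag n d = 1\<^sub>m n"
    unfolding mat_diag_diag using assms by (auto simp: mat_diag_def intro!: eq_matI)
  then show ?thesis
    by (auto simp: invertible_mat_def inverts_mat_def mat_diag_def)
qed

text \<open>The diagonal entry \<open>\<mu> * z j - \<nu>\<close> vanishes exactly when the pole
  \<nu> / \<mu> equals the node, written as \<open>z j / 1\<close>. For \<mu> = 0 the condition
  reads \<nu> \<noteq> 0, so infinite poles are included.\<close>

lemma invertible_shifted_mat_diag:
  assumes "\<And>j. j < m \<Longrightarrow> \<not> ratio_eq (z j) 1 \<nu> \<mu>"
  shows "invertible_mat (\<mu> \<cdot>\<^sub>m mat_diag m z - \<nu> \<cdot>\<^sub>m 1\<^sub>m m)"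
proof -
  have "\<mu> \<cdot>\<^sub>m mat_diag m z - \<nu> \<cdot>\<^sub>m 1\<^sub>m m = mat_diag m (\<lambda>j. \<mu> * z j - \<nu>)"
    by (auto simp: mat_diag_def intro!: eq_matI)
  then show ?thesis
    using assms by (auto simp: ratio_eq_def intro!: invertible_mat_diag)
qed

section \<open>Orthonormality from the Gram-Schmidt steps\<close>

text \<open>Subtracting from \<open>w k\<close> its components along the earlier vectors leaves a
  vector orthogonal to all of them, by induction on the larger index. Conjugate symmetry supplies
  the other order of the arguments.\<close>

lemma gram_schmidt_orthonormal:
  fixes q w :: "nat \<Rightarrow> complex vec"
  assumes q: "\<And>k. k < m \<Longrightarrow> q k \<in> carrier_vec m"
    and w: "\<And>k. Suc k < m \<Longrightarrow> w k \<in> carrier_vec m"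
    and norm: "\<And>k. k < m \<Longrightarrow> vec_norm (q k) = 1"
    and coeff: "\<And>i k. Suc k < m \<Longrightarrow> i \<le> k \<Longrightarrow> g i k = w k \<bullet>c q i"
    and nz: "\<And>k. Suc k < m \<Longrightarrow> g (Suc k) k \<noteq> 0"
    and step: "\<And>k. Suc k < m \<Longrightarrow> g (Suc k) k \<cdot>\<^sub>v q (Suc k)
      = w k - finsum_vec TYPE(complex) m (\<lambda>i. g i k \<cdot>\<^sub>v q i) {..k}"
  shows "i < m \<Longrightarrow> j < m \<Longrightarrow> q i \<bullet>c q j = (if i = j then 1 else 0)"
proof -
  have unit: "q k \<bullet>c q k = 1" if "k < m" for k
    using norm[OF that] by (simp add: cscalar_prod_self)
  have "q k \<bullet>c q j = 0" if "k < m" "j < k" for k j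
    using that
  proof (induction k arbitrary: j rule: less_induct)
    case (less k)
    then obtain l where l: "k = Suc l"
      by (cases k) auto
    \<comment> \<open>Both indices are below \<open>k\<close>, so the induction hypothesis applies
      to the larger of the two; for \<open>i < j\<close> the arguments are swapped first.\<close>
    have orth: "q i \<bullet>c q j = (if i = j then 1 else 0)" if "i \<le> l" for i
    proof (cases i j rule: linorder_cases)
      case less
      have "q j \<bullet>c q i = 0"
        using less \<open>j < k\<close> \<open>k < m\<close> less.IH[of j i] by auto
      then show ?thesis
        using less \<open>j < k\<close> \<open>k < m\<close> q cscalar_prod_swap[of "q i" m "q j"] by simp
    qed (use that l less.prems less.IH[of i j] unit in auto)
    have car: "finsum_vec TYPE(complex) m (\<lambda>i. g i l \<cdot>\<^sub>v q i) {..l} \<in> carrier_vec m"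
      using l less.prems q by (intro finsum_vec_closed) auto
    have "g k l * (q k \<bullet>c q j) = (g k l \<cdot>\<^sub>v q k) \<bullet>c q j"
      using q[of k] q[of j] less.prems by (simp add: smult_scalar_prod_distrib[of _ m])
    also have "\<dots> = w l \<bullet>c q j - finsum_vec TYPE(complex) m (\<lambda>i. g i l \<cdot>\<^sub>v q i) {..l} \<bullet>c q j"
      using step[of l] l less.prems w[of l] q[of j] car
      by (simp add: minus_scalar_prod_distrib[of _ m])
    also have "finsum_vec TYPE(complex) m (\<lambda>i. g i l \<cdot>\<^sub>v q i) {..l} \<bullet>c q j
        = (\<Sum>i\<le>l. g i l * (q i \<bullet>c q j))"
      using l less.prems q by (intro finsum_vec_sprod) auto
    \<comment> \<open>By \<open>orth\<close> only \<open>i = j\<close> survives, and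
      \<open>g j l\<close> is the inner product of \<open>w l\<close> with \<open>q j\<close>. The
      two terms cancel, and the nonzero factor \<open>g k l\<close> is divided out.\<close>
    also have "\<dots> = (\<Sum>i\<le>l. if i = j then g i l else 0)"
      using orth by (intro sum.cong) auto
    also have "\<dots> = g j l"
      using l less.prems by simp
    also have "w l \<bullet>c q j - g j l = 0"
      using coeff[of l j] l less.prems by simp
    finally show ?case
      using nz[of l] l less.prems by simp
  qed
  note lower = this
  assume ij: "i < m" "j < m"
  show ?thesis
  proof (cases i j rule: linorder_cases)
    case less
    then have "q j \<bullet>c q i = 0"
      using lower ij by auto
    then show ?thesis
      using less ij q cscalar_prod_swap[of "q i" m "q j"] by simp
  qed (use ij lower unit in auto)
qed

theorem theorem3p1:
  fixes m :: nat
    and z :: "nat \<Rightarrow> complex"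
    and v :: "complex vec"
    and \<mu> \<nu> \<rho> \<eta> :: "nat \<Rightarrow> complex"
    and t q :: "nat \<Rightarrow> complex vec"
    and c g :: "nat \<Rightarrow> nat \<Rightarrow> complex"
  assumes "m \<ge> 1"
    and "inj_on z {..<m}"
    and "v \<in> carrier_vec m"
    and "\<And>i. i < m \<Longrightarrow> v $ i \<noteq> 0"
    and "\<And>i. Suc i < m \<Longrightarrow> (\<mu> i, \<nu> i) \<noteq> (0, 0)"
    and "\<And>i j. Suc i < m \<Longrightarrow> j < m \<Longrightarrow> \<not> ratio_eq (z j) 1 (\<nu> i) (\<mu> i)"
    and "rational_arnoldi m (mat_diag m z) v \<mu> \<nu> \<rho> \<eta> t c g q"
  shows "solves_hpiep m (mat_diag m z) v \<mu> \<nu>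
           (arnoldi_Q m q) (arnoldi_H m \<nu> \<eta> c g) (arnoldi_K m \<mu> \<rho> c g)"
proof -

  \<comment> \<open>Facts read off from the iteration\<close>
  define Z where "Z = mat_diag m z"
  define w where "w k = rat_factor Z (\<rho> k) (\<eta> k) (\<mu> k) (\<nu> k) *\<^sub>v t k" for k
  define Q H K where "Q = arnoldi_Q m q" and "H = arnoldi_H m \<nu> \<eta> c g"
    and "K = arnoldi_K m \<mu> \<rho> c g"
  note arnoldi = assms(7)[unfolded rational_arnoldi_def Let_def, folded Z_def, folded w_def]
  have Z: "Z \<in> carrier_mat m m"
    by (simp add: Z_def)
  have q: "q k \<in> carrier_vec m" if "k < m" for k
    using arnoldi that by blast
  have q0: "q 0 = complex_of_real (1 / vec_norm v) \<cdot>\<^sub>v v"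
    using arnoldi by blast
  have t_sum: "t k = finsum_vec TYPE(complex) m (\<lambda>i. c i k \<cdot>\<^sub>v q i) {..k}" if "k < m" for k
    using arnoldi that by blast
  have coeff: "g i k = w k \<bullet>c q i" if "k < m" "i \<le> k" for i k
    using arnoldi that by blast
  have step: "g (Suc k) k \<cdot>\<^sub>v q (Suc k) = w k - finsum_vec TYPE(complex) m (\<lambda>i. g i k \<cdot>\<^sub>v q i) {..k}"
    and nz: "g (Suc k) k \<noteq> 0" and norm_Suc: "vec_norm (q (Suc k)) = 1" if "Suc k < m" for k
    using arnoldi that Suc_lessD by blast+
  have c0: "c i k = 0" if "i < m" "k < i" for i k
    using arnoldi that less_trans by blast
  have g0: "g i k = 0" if "i < m" "Suc k < i" for i k
    using arnoldi that by (meson Suc_lessD less_trans)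
  \<comment> \<open>Before the last step the poles avoid the nodes; in the last step the parameters
    are auxiliary, and invertibility is one of the conditions on them.\<close>
  have invert: "invertible_mat (\<mu> k \<cdot>\<^sub>m Z - \<nu> k \<cdot>\<^sub>m 1\<^sub>m m)" if "k < m" for k
  proof (cases "Suc k < m")
    case True
    then show ?thesis
      using assms(6)[of k] unfolding Z_def by (intro invertible_shifted_mat_diag)
  next
    case False
    with that have "k = m - 1"
      by simp
    then show ?thesis
      using arnoldi by blast
  qed
  have t: "t k \<in> carrier_vec m" if "k < m" for k
    unfolding t_sum[OF that] using that q by (intro finsum_vec_closed) auto
  have w: "w k \<in> carrier_vec m"
    and recur: "Z *\<^sub>v (\<mu> k \<cdot>\<^sub>v w k - \<rho> k \<cdot>\<^sub>v t k) = \<nu> k \<cdot>\<^sub>v w k - \<eta> k \<cdot>\<^sub>v t k" if "k < m" for k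
    using rat_factor_recurrence[OF Z invert t] that by (auto simp: w_def)

  \<comment> \<open>Orthonormal basis and unitarity of \<open>Q\<close>\<close>
  have "v \<noteq> 0\<^sub>v m"
    using assms(1) assms(4)[of 0] by auto
  then have norm_v: "vec_norm v > 0"
    using assms(3) by (intro vec_norm_pos)
  have "q 0 \<bullet>c q 0 = 1"
    using norm_v assms(3) by (simp add: q0 conjugate_smult_vec cscalar_prod_self power2_eq_square)
  then have norm0: "vec_norm (q 0) = 1"
    by (simp add: vec_norm_def)
  \<comment> \<open>The first vector is normalised by explicit scaling of the nonzero
    \<open>v\<close>, the later ones by the iteration.\<close>
  have norm: "vec_norm (q k) = 1" if "k < m" for k
    using that norm0 norm_Suc by (cases k) auto
  have orth: "q i \<bullet>c q j = (if i = j then 1 else 0)" if "i < m" "j < m" for i j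
    using gram_schmidt_orthonormal[of m q w g i j] q w norm coeff nz step that by simp
  have Q: "Q \<in> carrier_mat m m"
    by (simp add: Q_def arnoldi_Q_carrier)
  have col_Q: "col Q j = q j" if "j < m" for j
    using that q[OF that] unfolding Q_def arnoldi_Q_def by (subst col_mat_of_cols) auto
  have unitary: "unitary_mat Q"
    using Q orth by (intro unitary_mat_orthonormal_cols) (auto simp: col_Q)
  have adj: "mat_adjoint Q \<in> carrier_mat m m"
    using Q by (auto simp: mat_adjoint_def)
  have adj_Q: "mat_adjoint Q * Q = 1\<^sub>m m" and Q_adj: "Q * mat_adjoint Q = 1\<^sub>m m"
    using unitary Q adj by (auto simp: unitary_mat_def inverts_mat_def)

  \<comment> \<open>Coordinates of \<open>t k\<close> and \<open>w k\<close> in the basis\<close>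
  have t_Q: "t k = Q *\<^sub>v vec m (\<lambda>i. c i k)" if "k < m" for k
    unfolding t_sum[OF that] Q_def using that q c0 by (intro finsum_vec_eq_arnoldi_Q_mult) auto
  have w_Q: "w k = Q *\<^sub>v vec m (\<lambda>i. g i k)" if "k < m" for k
  proof (cases "Suc k < m")
    case True
    \<comment> \<open>This is the Gram-Schmidt step solved for \<open>w k\<close>; the remainder
      contributes the term with index \<open>Suc k\<close>.\<close>
    have "w k = finsum_vec TYPE(complex) m (\<lambda>i. g i k \<cdot>\<^sub>v q i) {..Suc k}"
    proof (rule eq_vecI)
      fix l assume "l < dim_vec (finsum_vec TYPE(complex) m (\<lambda>i. g i k \<cdot>\<^sub>v q i) {..Suc k})"
      moreover have "finsum_vec TYPE(complex) m (\<lambda>i. g i k \<cdot>\<^sub>v q i) {..j} \<in> carrier_vec m"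
        if "j < m" for j
        using that q by (intro finsum_vec_closed) auto
      ultimately have l: "l < m"
        and car: "finsum_vec TYPE(complex) m (\<lambda>i. g i k \<cdot>\<^sub>v q i) {..k} \<in> carrier_vec m"
        using True by (metis carrier_vecD, simp)
      have index: "finsum_vec TYPE(complex) m (\<lambda>i. g i k \<cdot>\<^sub>v q i) {..j} $ l
          = (\<Sum>i\<le>j. g i k * q i $ l)" if "j < m" for j
        using that l q by (intro index_finsum_vec_smult) auto
      have "g (Suc k) k * q (Suc k) $ l = (g (Suc k) k \<cdot>\<^sub>v q (Suc k)) $ l"
        using l q[OF True] by simp
      also have "\<dots> = w k $ l - (\<Sum>i\<le>k. g i k * q i $ l)"
        unfolding step[OF True] using l True car by (simp add: index)
      finally show "w k $ l = finsum_vec TYPE(complex) m (\<lambda>i. g i k \<cdot>\<^sub>v q i) {..Suc k} $ l"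
        using True by (simp add: index algebra_simps)
    next
      have "finsum_vec TYPE(complex) m (\<lambda>i. g i k \<cdot>\<^sub>v q i) {..Suc k} \<in> carrier_vec m"
        using True q by (intro finsum_vec_closed) auto
      then show "dim_vec (w k) = dim_vec (finsum_vec TYPE(complex) m (\<lambda>i. g i k \<cdot>\<^sub>v q i) {..Suc k})"
        using w[OF that] by auto
    qed
    then show ?thesis
      unfolding Q_def using True q g0 by (simp add: finsum_vec_eq_arnoldi_Q_mult)
  next
    case False
    \<comment> \<open>Here \<open>k = m - 1\<close>, so the coefficients
      \<open>g 0 k, ..., g k k\<close> are the inner products of \<open>w k\<close> with the whole
      basis. They recover \<open>w k\<close> because \<open>Q\<close> is unitary.\<close>
    have "mat_adjoint Q *\<^sub>v w k = vec m (\<lambda>i. g i k)"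
    proof (rule eq_vecI)
      fix i assume "i < dim_vec (vec m (\<lambda>i. g i k))"
      then have i: "i < m" "i \<le> k"
        using False that by auto
      have "(mat_adjoint Q *\<^sub>v w k) $ i = conjugate (col Q i) \<bullet> w k"
        using i Q by (simp add: mat_adjoint_def)
      also have "\<dots> = w k \<bullet>c q i"
        using i Q w[OF that] q by (simp add: col_Q comm_scalar_prod[of _ m])
      finally show "(mat_adjoint Q *\<^sub>v w k) $ i = vec m (\<lambda>i. g i k) $ i"
        using i coeff that by simp
    qed (use adj in auto)
    then have "Q *\<^sub>v vec m (\<lambda>i. g i k) = Q * mat_adjoint Q *\<^sub>v w k"
      using Q adj w[OF that] by simp
    then show ?thesis
      using Q_adj w[OF that] by simp
  qed

  \<comment> \<open>The pencil equation\<close>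
  have H: "H \<in> carrier_mat m m" and K: "K \<in> carrier_mat m m"
    by (auto simp: H_def K_def arnoldi_H_def arnoldi_K_def)
  \<comment> \<open>Column \<open>k\<close> of \<open>H\<close> or \<open>K\<close> combines the
    coordinate vectors of \<open>w k\<close> and \<open>t k\<close>; linearity passes from
    coordinates to the vectors themselves.\<close>
  have lin: "Q *\<^sub>v vec m (\<lambda>i. a * x i - b * y i) = a \<cdot>\<^sub>v (Q *\<^sub>v vec m x) - b \<cdot>\<^sub>v (Q *\<^sub>v vec m y)"
    for a b x y
  proof -
    have "vec m (\<lambda>i. a * x i - b * y i) = a \<cdot>\<^sub>v vec m x - b \<cdot>\<^sub>v vec m y"
      by auto
    then show ?thesis
      using Q by (simp add: mult_minus_distrib_mat_vec[of _ m m] mult_mat_vec[of _ m m])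
  qed
  have col_H: "Q *\<^sub>v col H k = \<nu> k \<cdot>\<^sub>v w k - \<eta> k \<cdot>\<^sub>v t k" if "k < m" for k
    using that lin[of "\<nu> k" "\<lambda>i. g i k" "\<eta> k" "\<lambda>i. c i k"]
    by (simp add: H_def arnoldi_H_def col_mat w_Q t_Q)
  have col_K: "Q *\<^sub>v col K k = \<mu> k \<cdot>\<^sub>v w k - \<rho> k \<cdot>\<^sub>v t k" if "k < m" for k
    using that lin[of "\<mu> k" "\<lambda>i. g i k" "\<rho> k" "\<lambda>i. c i k"]
    by (simp add: K_def arnoldi_K_def col_mat w_Q t_Q)
  have "Z * (Q * K) = Q * H"
  proof (rule mat_col_eqI)
    fix k assume "k < dim_col (Q * H)"
    then have k: "k < m"
      using H by simp
    have "col (Z * (Q * K)) k = Z *\<^sub>v (Q *\<^sub>v col K k)"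
      using k by (simp only: col_mult2[OF Z mult_carrier_mat[OF Q K]] col_mult2[OF Q K])
    \<comment> \<open>The columns of \<open>K\<close> and \<open>H\<close>, mapped by
      \<open>Q\<close>, are exactly the vectors that \<open>recur\<close> relates through
      \<open>Z\<close>.\<close>
    also have "\<dots> = Q *\<^sub>v col H k"
      by (simp add: k col_H col_K recur)
    finally show "col (Z * (Q * K)) k = col (Q * H) k"
      using k by (simp only: col_mult2[OF Q H])
  qed (use Z Q H K in auto)
  then have "mat_adjoint Q * (Z * (Q * K)) = mat_adjoint Q * Q * H"
    using adj Q H by (simp add: assoc_mult_mat[of _ m m _ m _ m])
  then have pencil: "mat_adjoint Q * Z * Q * K = H"
    using adj Q H K Z adj_Q by (simp add: assoc_mult_mat[of _ m m _ m _ m])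

  \<comment> \<open>Hessenberg shape, first column and pole ratios\<close>
  have "upper_hessenberg H" "upper_hessenberg K"
    using c0 g0 by (auto simp: upper_hessenberg_def H_def K_def arnoldi_H_def arnoldi_K_def)
  moreover have "Q *\<^sub>v unit_vec m 0 = complex_of_real (1 / vec_norm v) \<cdot>\<^sub>v v"
    using assms(1) col_Q[of 0] q0 col_mult2[OF Q one_carrier_mat, of 0] Q by simp
  \<comment> \<open>As \<open>c (Suc i) i = 0\<close>, the subdiagonal entries are
    \<open>\<nu> i\<close> and \<open>\<mu> i\<close> times the same nonzero number
    \<open>g (Suc i) i\<close>. They are not both zero because \<open>(\<mu> i, \<nu> i)\<close> is
    not the zero pair.\<close>
  moreover have "ratio_eq (H $$ (Suc i, i)) (K $$ (Suc i, i)) (\<nu> i) (\<mu> i)" if "Suc i < m" for i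
    using that assms(5)[of i] c0[of "Suc i" i] nz[of i]
    by (auto simp: ratio_eq_def H_def K_def arnoldi_H_def arnoldi_K_def)
  ultimately show ?thesis
    using Q H K unitary pencil
    by (simp add: solves_hpiep_def flip: Z_def Q_def H_def K_def)
qed

end
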